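(* For every integer $t \geq 2$, there exists a Latin square of order $n=t^2+t$ that contains a minimal $c$-cover for every $c \in \{t^2+t, t^2+t+1, \ldots, 3t^2\}$.
   Context: A Latin square of order $n$ is an $n\times n$ array on $n$ symbols in which each symbol occurs once in each row and each column; its entries are the triples $(i,j,L_{ij})$. A line is the set of all entries in a given row, in a given column, or with a given symbol. A cover is a set of entries meeting every line; a $c$-cover is a cover of size $c$. A cover $\mathscr{C}$ is minimal if for every entry $\mathbf{e}\in\mathscr{C}$ the set $\mathscr{C}\setminus\{\mathbf{e}\}$ is not a cover. *)

theory Defs
  imports Main
begin

(* Rows, columns and symbols of a square of order n are all indexed by 0, ..., n - 1;
   the values of L outside this range are irrelevant. *)
definition latin_square :: "nat \<Rightarrow> (nat \<Rightarrow> nat \<Rightarrow> nat) \<Rightarrow> bool" where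
  "latin_square n L \<longleftrightarrow>
     (\<forall>i<n. \<forall>j<n. L i j < n) \<and>
     (\<forall>i<n. \<forall>s<n. \<exists>!j. j < n \<and> L i j = s) \<and>
     (\<forall>j<n. \<forall>s<n. \<exists>!i. i < n \<and> L i j = s)"

definition entries :: "nat \<Rightarrow> (nat \<Rightarrow> nat \<Rightarrow> nat) \<Rightarrow> (nat \<times> nat \<times> nat) set" where
  "entries n L = {(i, j, L i j) | i j. i < n \<and> j < n}"

definition row_line :: "nat \<Rightarrow> (nat \<Rightarrow> nat \<Rightarrow> nat) \<Rightarrow> nat \<Rightarrow> (nat \<times> nat \<times> nat) set" where
  "row_line n L r = {(i, j, s) \<in> entries n L. i = r}"

definition column_line :: "nat \<Rightarrow> (nat \<Rightarrow> nat \<Rightarrow> nat) \<Rightarrow> nat \<Rightarrow> (nat \<times> nat \<times> nat) set" where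
  "column_line n L c = {(i, j, s) \<in> entries n L. j = c}"

definition symbol_line :: "nat \<Rightarrow> (nat \<Rightarrow> nat \<Rightarrow> nat) \<Rightarrow> nat \<Rightarrow> (nat \<times> nat \<times> nat) set" where
  "symbol_line n L k = {(i, j, s) \<in> entries n L. s = k}"

definition lines :: "nat \<Rightarrow> (nat \<Rightarrow> nat \<Rightarrow> nat) \<Rightarrow> (nat \<times> nat \<times> nat) set set" where
  "lines n L = row_line n L ` {..<n} \<union> column_line n L ` {..<n} \<union> symbol_line n L ` {..<n}"

definition is_cover :: "nat \<Rightarrow> (nat \<Rightarrow> nat \<Rightarrow> nat) \<Rightarrow> (nat \<times> nat \<times> nat) set \<Rightarrow> bool" where
  "is_cover n L C \<longleftrightarrow> C \<subseteq> entries n L \<and> (\<forall>l\<in>lines n L. C \<inter> l \<noteq> {})"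

definition minimal_cover :: "nat \<Rightarrow> (nat \<Rightarrow> nat \<Rightarrow> nat) \<Rightarrow> (nat \<times> nat \<times> nat) set \<Rightarrow> bool" where
  "minimal_cover n L C \<longleftrightarrow> is_cover n L C \<and> (\<forall>e\<in>C. \<not> is_cover n L (C - {e}))"

end

theory Submission
  imports Defs Complex_Main
begin

text \<open>
  The square is built over a cyclic group \<open>G\<close> of order \<open>t\<close>, with \<open>t\<close> ``short'' and \<open>t\<^sup>2\<close> ``long'' lines
  of each kind, so that every long line contains a base entry whose other two lines are short. The
  \<open>3 t\<^sup>2\<close> base entries form a minimal cover. Any entry of a cover whose long lines are met by no
  other entry of the cover can be expanded, that is, replaced by the base entries of its long lines;
  the cover stays minimal as long as the short lines remain covered, and an entry with \<open>d\<close> long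
  lines contributes \<open>d - 1\<close> to the size. It therefore suffices to find a transversal (size
  \<open>t\<^sup>2 + t\<close>) and a minimal cover of size \<open>t\<^sup>2 + t + 1\<close> in which many entries have three long lines,
  and to expand these one after the other.

  For even \<open>t\<close> both come from an element of order two and a choice of representatives modulo
  \<open>\<plusminus>1\<close>; expanding reaches all sizes of either parity. For odd \<open>t\<close> the transversal deviates from
  the diagonal along two translates of the diagonal subgroup, and the largest sizes are reached by
  expanding the remaining entries, which have two long lines, as well.
\<close>

section \<open>Latin squares over an arbitrary index set\<close>

datatype 'b line = Row 'b | Col 'b | Sym 'b

fun lines_of :: "('b \<Rightarrow> 'b \<Rightarrow> 'b) \<Rightarrow> 'b \<times> 'b \<Rightarrow> 'b line set" where
  "lines_of Q (p, q) = {Row p, Col q, Sym (Q p q)}"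

definition lines_over :: "'b set \<Rightarrow> 'b line set" where
  "lines_over I = Row ` I \<union> Col ` I \<union> Sym ` I"

text \<open>A cell \<open>(p, q)\<close> stands for the entry in row \<open>p\<close> and column
  \<open>q\<close>. Minimality takes a local form: each cell has a line met by no other cell, and
  its deletion uncovers that line.\<close>

definition irredundant_cover ::
    "'b set \<Rightarrow> ('b \<Rightarrow> 'b \<Rightarrow> 'b) \<Rightarrow> ('b \<times> 'b) set \<Rightarrow> bool" where
  "irredundant_cover I Q Z \<longleftrightarrow> Z \<subseteq> I \<times> I \<and>
     (\<forall>l\<in>lines_over I. \<exists>z\<in>Z. l \<in> lines_of Q z) \<and>
     (\<forall>z\<in>Z. \<exists>l\<in>lines_of Q z. \<forall>z'\<in>Z. l \<in> lines_of Q z' \<longrightarrow> z' = z)"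

lemma ex1_of_inj:
  assumes "finite A" "inj_on f A" "f ` A \<subseteq> A" "s \<in> A"
  shows "\<exists>!x. x \<in> A \<and> f x = s"
proof -
  have "f ` A = A" using endo_inj_surj[OF assms(1,3,2)] .
  then show ?thesis using assms(2,4) unfolding inj_on_def by (metis imageE)
qed

text \<open>A bijection from \<open>I\<close> to the numbers below \<open>n\<close> carries cells to
  entries and line names to lines. It is chosen before \<open>Z\<close>, so one \<open>L\<close>
  serves covers of all sizes.\<close>

lemma latin_square_transfer:
  fixes Q :: "'b \<Rightarrow> 'b \<Rightarrow> 'b"
  assumes fin: "finite I" and n: "card I = n"
    and closed: "\<And>p q. p \<in> I \<Longrightarrow> q \<in> I \<Longrightarrow> Q p q \<in> I"
    and injr: "\<And>p. p \<in> I \<Longrightarrow> inj_on (Q p) I"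
    and injc: "\<And>q. q \<in> I \<Longrightarrow> inj_on (\<lambda>p. Q p q) I"
  shows "\<exists>L. latin_square n L \<and>
    (\<forall>Z. irredundant_cover I Q Z \<longrightarrow> (\<exists>C. minimal_cover n L C \<and> card C = card Z))"
proof -
  obtain f where f: "bij_betw f I {..<n}"
    using finite_same_card_bij[OF fin, of "{..<n}"] n by auto
  define g where "g = the_inv_into I f"
  have gf: "\<And>p. p \<in> I \<Longrightarrow> g (f p) = p" and fn: "\<And>p. p \<in> I \<Longrightarrow> f p < n"
    and gI: "\<And>i. i < n \<Longrightarrow> g i \<in> I" and fg: "\<And>i. i < n \<Longrightarrow> f (g i) = i"
    using f unfolding g_def bij_betw_def
    by (auto simp: the_inv_into_f_f f_the_inv_into_f the_inv_into_into)
  define L where "L i j = f (Q (g i) (g j))" for i j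
  have Ln: "L i j < n" if "i < n" "j < n" for i j
    using that by (simp add: L_def fn closed gI)
  have inj1: "inj_on (\<lambda>j. L i j) {..<n}" if "i < n" for i
  proof (rule inj_onI)
    fix j j' assume "j \<in> {..<n}" "j' \<in> {..<n}" "L i j = L i j'"
    then have "Q (g i) (g j) = Q (g i) (g j')"
      unfolding L_def using gf closed gI \<open>i < n\<close> by (metis lessThan_iff)
    then have "g j = g j'"
      using injr[OF gI[OF \<open>i < n\<close>]] gI \<open>j \<in> _\<close> \<open>j' \<in> _\<close> by (auto dest: inj_onD)
    then show "j = j'" using fg \<open>j \<in> _\<close> \<open>j' \<in> _\<close> by (metis lessThan_iff)
  qed
  have inj2: "inj_on (\<lambda>i. L i j) {..<n}" if "j < n" for j
  proof (rule inj_onI)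
    fix i i' assume "i \<in> {..<n}" "i' \<in> {..<n}" "L i j = L i' j"
    then have "Q (g i) (g j) = Q (g i') (g j)"
      unfolding L_def using gf closed gI \<open>j < n\<close> by (metis lessThan_iff)
    then have "g i = g i'"
      using injc[OF gI[OF \<open>j < n\<close>]] gI \<open>i \<in> _\<close> \<open>i' \<in> _\<close> by (auto dest: inj_onD)
    then show "i = i'" using fg \<open>i \<in> _\<close> \<open>i' \<in> _\<close> by (metis lessThan_iff)
  qed
  have latin: "latin_square n L"
    unfolding latin_square_def
  proof (intro conjI allI impI)
    fix i s assume "i < n" "s < n"
    then show "\<exists>!j. j < n \<and> L i j = s"
      using ex1_of_inj[OF finite_lessThan inj1, of i s] Ln by auto
  next
    fix j s assume "j < n" "s < n"
    then show "\<exists>!i. i < n \<and> L i j = s"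
      using ex1_of_inj[OF finite_lessThan inj2, of j s] Ln by auto
  qed (rule Ln)
  have "\<exists>C. minimal_cover n L C \<and> card C = card Z" if Z: "irredundant_cover I Q Z" for Z
  proof -
    define F where "F = (\<lambda>(p, q). (f p, f q, f (Q p q)))"
    define C where "C = F ` Z"
    have ZI: "Z \<subseteq> I \<times> I"
      and cov: "\<And>l. l \<in> lines_over I \<Longrightarrow> \<exists>z\<in>Z. l \<in> lines_of Q z"
      and priv: "\<And>z. z \<in> Z \<Longrightarrow> \<exists>l\<in>lines_of Q z. \<forall>z'\<in>Z. l \<in> lines_of Q z' \<longrightarrow> z' = z"
      using Z unfolding irredundant_cover_def by auto
    have FI: "F z \<in> entries n L" if "z \<in> I \<times> I" for z
      using that by (auto simp: F_def entries_def L_def gf fn)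
    have injF: "inj_on F (I \<times> I)"
      by (rule inj_onI) (auto simp: F_def dest: arg_cong[of _ _ g] simp: gf)
    define enc where "enc l = (case l of Row p \<Rightarrow> row_line n L (f p)
      | Col p \<Rightarrow> column_line n L (f p) | Sym p \<Rightarrow> symbol_line n L (f p))" for l
    have feq: "f p = f q \<longleftrightarrow> p = q" if "p \<in> I" "q \<in> I" for p q
      using that gf by metis
    have enc: "F z \<in> enc l \<longleftrightarrow> l \<in> lines_of Q z" if "z \<in> I \<times> I" "l \<in> lines_over I" for z l
    proof -
      obtain p q where z: "z = (p, q)" "p \<in> I" "q \<in> I"
        using \<open>z \<in> I \<times> I\<close> by auto
      show ?thesis
        using that(2) FI[OF that(1)] z closed[of p q]
        by (cases l) (auto simp: enc_def F_def row_line_def column_line_def symbol_line_def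
            lines_over_def feq)
    qed
    have lines: "lines n L = enc ` lines_over I"
    proof -
      have "{..<n} = f ` I" using f by (simp add: bij_betw_def)
      then show ?thesis
        unfolding lines_def lines_over_def image_Un image_image by (simp add: enc_def image_image)
    qed
    have cover: "is_cover n L C"
      unfolding is_cover_def lines
    proof (intro conjI ballI)
      show "C \<subseteq> entries n L" using FI ZI unfolding C_def by blast
      fix l assume "l \<in> enc ` lines_over I"
      then obtain m where m: "m \<in> lines_over I" "l = enc m" by auto
      with cov obtain z where "z \<in> Z" "m \<in> lines_of Q z" by blast
      then have "F z \<in> C \<inter> l" using enc m ZI unfolding C_def by blast
      then show "C \<inter> l \<noteq> {}" by blast
    qed
    have "\<not> is_cover n L (C - {e})" if "e \<in> C" for e
    proof
      assume cov': "is_cover n L (C - {e})"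
      obtain z where z: "z \<in> Z" "e = F z"
        using \<open>e \<in> C\<close> unfolding C_def by blast
      obtain l where l: "l \<in> lines_of Q z" "\<forall>z'\<in>Z. l \<in> lines_of Q z' \<longrightarrow> z' = z"
        using priv[OF z(1)] by auto
      have lI: "l \<in> lines_over I"
        using l(1) z(1) ZI closed by (cases z) (auto simp: lines_over_def)
      then have "(C - {e}) \<inter> enc l \<noteq> {}"
        using cov' unfolding is_cover_def lines by blast
      then obtain z' where z': "z' \<in> Z" "F z' \<noteq> e" "F z' \<in> enc l" unfolding C_def by blast
      then have "l \<in> lines_of Q z'" using enc lI ZI by blast
      with l(2) z'(1) have "z' = z" by blast
      with z'(2) z(2) show False by blast
    qed
    moreover have "card C = card Z"
      unfolding C_def using card_image inj_on_subset[OF injF ZI] by blast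
    ultimately show ?thesis using cover unfolding minimal_cover_def by blast
  qed
  with latin show ?thesis by blast
qed

section \<open>The square\<close>

datatype 'a label = Short 'a | is_Long: Long 'a 'a

fun long_line :: "'a label line \<Rightarrow> bool" where
  "long_line (Row p) = is_Long p"
| "long_line (Col p) = is_Long p"
| "long_line (Sym p) = is_Long p"

text \<open>
  For each kind of line the long ones are indexed by \<open>G \<times> G\<close>. The indices are chosen so that the long
  row, column and symbol \<open>Long w v\<close> share the entry \<open>(Long w v, Long w v)\<close>, while the base entries
  of these three lines pairwise share one of the short lines row \<open>w\<close>, column \<open>w * v\<close>, symbol \<open>v\<close>.
\<close>

fun prd :: "'a::field label \<Rightarrow> 'a label \<Rightarrow> 'a label" where
  "prd (Short a) (Short b) = Long a (b / a)"
| "prd (Short a) (Long w v) = (if a = w then Short v else Long w (v * a / w))"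
| "prd (Long w v) (Short b) = (if b = w * v then Short v else Long (b / v) (w * v * v / b))"
| "prd (Long w v) (Long x y) =
    (if y = v \<and> x \<noteq> w then Short (x * v / w) else Long (x * y / v) (w * v / x))"

text \<open>Only long lines have a base cell; \<open>expand\<close> applies the map to nothing else,
  so the default value is never reached.\<close>

fun base_cell :: "'a::field label line \<Rightarrow> 'a label \<times> 'a label" where
  "base_cell (Row (Long w v)) = (Long w v, Short (w * v))"
| "base_cell (Col (Long w v)) = (Short w, Long w v)"
| "base_cell (Sym (Long w v)) = (Short w, Short (w * v))"
| "base_cell _ = undefined"

abbreviation cell_lines :: "'a::field label \<times> 'a label \<Rightarrow> 'a label line set" where
  "cell_lines \<equiv> lines_of prd"

definition long_lines :: "'a::field label \<times> 'a label \<Rightarrow> 'a label line set" where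
  "long_lines z = {l \<in> cell_lines z. long_line l}"

definition private_line :: "('a::field label \<times> 'a label) set \<Rightarrow> 'a label line \<Rightarrow> bool" where
  "private_line Z l \<longleftrightarrow> (\<forall>z\<in>Z. \<forall>z'\<in>Z. l \<in> cell_lines z \<longrightarrow> l \<in> cell_lines z' \<longrightarrow> z' = z)"

locale unit_group =
  fixes G :: "'a::field set" and t :: nat
  assumes card_G: "card G = t" and t_pos: "0 < t"
    and zero: "0 \<notin> G" and one: "1 \<in> G"
    and mult: "a \<in> G \<Longrightarrow> b \<in> G \<Longrightarrow> a * b \<in> G"
    and divide: "a \<in> G \<Longrightarrow> b \<in> G \<Longrightarrow> a / b \<in> G"
begin

lemma finite_G: "finite G"
  using card_G t_pos card_ge_0_finite by auto

lemma nz: "a \<in> G \<Longrightarrow> a \<noteq> 0"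
  using zero by auto

definition labels :: "'a label set" where
  "labels = Short ` G \<union> (\<lambda>(w, v). Long w v) ` (G \<times> G)"

lemma labels_simps [simp]:
  "Short a \<in> labels \<longleftrightarrow> a \<in> G"
  "Long w v \<in> labels \<longleftrightarrow> w \<in> G \<and> v \<in> G"
  by (auto simp: labels_def)

lemma finite_labels: "finite labels"
  by (simp add: labels_def finite_G)

lemma card_labels: "card labels = t\<^sup>2 + t"
proof -
  have "card labels = card (Short ` G) + card ((\<lambda>(w, v). Long w v) ` (G \<times> G))"
    unfolding labels_def by (rule card_Un_disjoint) (auto simp: finite_G)
  also have "card (Short ` G) = t" by (simp add: card_image inj_on_def card_G)
  also have "card ((\<lambda>(w, v). Long w v) ` (G \<times> G)) = card (G \<times> G)"
    by (rule card_image) (auto simp: inj_on_def)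
  finally show ?thesis by (simp add: card_cartesian_product card_G power2_eq_square)
qed

lemma prd_closed: "p \<in> labels \<Longrightarrow> q \<in> labels \<Longrightarrow> prd p q \<in> labels"
  by (cases p; cases q) (auto simp: mult divide)

text \<open>In row \<open>Long w v\<close> the columns \<open>Long x v\<close> with
  \<open>x \<noteq> w\<close> get short symbols; the long symbols \<open>Long x (w * v / x)\<close>
  that they give up go to the columns \<open>Short (x * v)\<close>. Within a column, short rows take
  the vacated symbols in the same way.\<close>

lemma prd_inj_right: assumes "p \<in> labels" shows "inj_on (prd p) labels"
proof (rule inj_onI)
  fix q q' assume "q \<in> labels" "q' \<in> labels" "prd p q = prd p q'"
  then show "q = q'"
    using assms
    by (cases p; cases q; cases q') (auto simp: nz field_simps split: if_splits)
qed

lemma prd_inj_left: assumes "q \<in> labels" shows "inj_on (\<lambda>p. prd p q) labels"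
proof (rule inj_onI)
  fix p p' assume "p \<in> labels" "p' \<in> labels" "prd p q = prd p' q"
  then show "p = p'"
    using assms
    by (cases q; cases p; cases p') (auto simp: nz field_simps split: if_splits)
qed

subsection \<open>Expanding and exchanging entries of covers\<close>

text \<open>Expansion can put further entries on a short line, so only a long private line is sure
  to survive it.\<close>

definition good_cover :: "('a label \<times> 'a label) set \<Rightarrow> bool" where
  "good_cover Z \<longleftrightarrow> Z \<subseteq> labels \<times> labels \<and>
     (\<forall>l\<in>lines_over labels. \<exists>z\<in>Z. l \<in> cell_lines z) \<and>
     (\<forall>z\<in>Z. \<exists>l\<in>long_lines z. private_line Z l)"

lemma good_imp_irredundant:
  assumes "good_cover Z" shows "irredundant_cover labels prd Z"
  unfolding irredundant_cover_def
proof (intro conjI ballI)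
  fix z assume z: "z \<in> Z"
  then obtain l where "l \<in> long_lines z" "private_line Z l"
    using assms by (auto simp: good_cover_def)
  then show "\<exists>l\<in>cell_lines z. \<forall>z'\<in>Z. l \<in> cell_lines z' \<longrightarrow> z' = z"
    using z unfolding private_line_def long_lines_def by blast
qed (use assms in \<open>auto simp: good_cover_def\<close>)

lemma finite_cover: "Z \<subseteq> labels \<times> labels \<Longrightarrow> finite Z"
  by (meson finite_SigmaI finite_labels finite_subset)

lemma cell_lines_over: "z \<in> labels \<times> labels \<Longrightarrow> cell_lines z \<subseteq> lines_over labels"
  by (auto simp: lines_over_def prd_closed)

lemma base_cell:
  assumes "l \<in> lines_over labels" "long_line l"
  shows "base_cell l \<in> labels \<times> labels" "long_lines (base_cell l) = {l}"
proof -
  obtain w v where "l = Row (Long w v) \<or> l = Col (Long w v) \<or> l = Sym (Long w v)"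
    using assms(2) by (cases l) (auto simp: is_Long_def)
  then show "base_cell l \<in> labels \<times> labels" "long_lines (base_cell l) = {l}"
    using assms(1) by (auto simp: lines_over_def long_lines_def mult nz)
qed

lemma finite_long_lines: "finite (long_lines z)"
  by (cases z) (auto simp: long_lines_def intro: finite_subset[of _ "cell_lines z"])

definition expand :: "('a label \<times> 'a label) set \<Rightarrow> ('a label \<times> 'a label) set \<Rightarrow> ('a label \<times> 'a label) set" where
  "expand Z E = (Z - E) \<union> base_cell ` (\<Union>z\<in>E. long_lines z)"

lemma expand_good:
  assumes Z: "good_cover Z" and E: "E \<subseteq> Z"
    and priv: "\<And>z l. z \<in> E \<Longrightarrow> l \<in> long_lines z \<Longrightarrow> private_line Z l"
    and short: "\<And>l. l \<in> lines_over labels \<Longrightarrow> \<not> long_line l \<Longrightarrow> \<exists>z\<in>expand Z E. l \<in> cell_lines z"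
  shows "good_cover (expand Z E)"
    and "card (expand Z E) + card E = card Z + (\<Sum>z\<in>E. card (long_lines z))"
proof -
  define M where "M = (\<Union>z\<in>E. long_lines z)"
  have ZI: "Z \<subseteq> labels \<times> labels" using Z by (simp add: good_cover_def)
  have M: "l \<in> lines_over labels" "long_line l" if "l \<in> M" for l
    using that E ZI cell_lines_over unfolding M_def long_lines_def by blast+
  have Mout: "l \<notin> cell_lines z" if "l \<in> M" "z \<in> Z - E" for l z
    using that priv E unfolding M_def private_line_def long_lines_def by blast
  have base_M: "base_cell l \<in> labels \<times> labels" "long_lines (base_cell l) = {l}" if "l \<in> M" for l
    using base_cell[OF M[OF that]] by auto
  have ex: "expand Z E = (Z - E) \<union> base_cell ` M" by (simp add: expand_def M_def)
  have long_base: "m = l" if "l \<in> M" "m \<in> cell_lines (base_cell l)" "long_line m" for l m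
    using base_M(2)[OF that(1)] that(2,3) unfolding long_lines_def by blast
  have base_self: "l \<in> cell_lines (base_cell l)" if "l \<in> M" for l
    using base_M(2)[OF that(1)] unfolding long_lines_def by blast
  show "good_cover (expand Z E)"
    unfolding good_cover_def
  proof (intro conjI ballI)
    show "expand Z E \<subseteq> labels \<times> labels" using ZI base_M(1) unfolding ex by blast
  next
    fix l assume l: "l \<in> lines_over labels"
    show "\<exists>z\<in>expand Z E. l \<in> cell_lines z"
    proof (cases "long_line l")
      case True
      obtain z where z: "z \<in> Z" "l \<in> cell_lines z" using Z l unfolding good_cover_def by blast
      show ?thesis
      proof (cases "z \<in> E")
        case True
        then have "l \<in> M" using \<open>long_line l\<close> z unfolding M_def long_lines_def by blast
        then show ?thesis using base_self unfolding ex by blast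
      qed (use z in \<open>auto simp: ex\<close>)
    qed (rule short[OF l])
  next
    fix z assume "z \<in> expand Z E"
    then consider "z \<in> Z - E" | l where "l \<in> M" "z = base_cell l" unfolding ex by blast
    then show "\<exists>l\<in>long_lines z. private_line (expand Z E) l"
    proof cases
      case 1
      then obtain l where l: "l \<in> long_lines z" "private_line Z l"
        using Z unfolding good_cover_def by blast
      \<comment> \<open>A remaining cell keeps its private long line: the line is outside
        \<open>M\<close>, and the added base cells have no long line outside
        \<open>M\<close>.\<close>
      have "l \<notin> M" using Mout 1 l(1) unfolding long_lines_def by blast
      then have "private_line (expand Z E) l"
        using l long_base unfolding private_line_def ex long_lines_def by blast
      with l(1) show ?thesis by blast
    next
      case 2
      have "private_line (expand Z E) l"
        using 2 Mout long_base M(2) unfolding private_line_def ex by blast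
      then show ?thesis using base_M(2)[OF 2(1)] 2(2) by blast
    qed
  qed
  have fin: "finite Z" "finite E" using finite_cover[OF ZI] E finite_subset by auto
  have "inj_on base_cell M"
    by (rule inj_onI) (metis base_M(2) singleton_inject)
  moreover have "card M = (\<Sum>z\<in>E. card (long_lines z))"
    unfolding M_def
  proof (rule card_UN_disjoint)
    show "\<forall>z\<in>E. \<forall>z'\<in>E. z \<noteq> z' \<longrightarrow> long_lines z \<inter> long_lines z' = {}"
      using priv E unfolding private_line_def long_lines_def by blast
  qed (auto simp: fin finite_long_lines)
  moreover have "card (expand Z E) = card (Z - E) + card (base_cell ` M)"
    unfolding ex
  proof (rule card_Un_disjoint)
    show "finite (base_cell ` M)" unfolding M_def by (auto simp: fin finite_long_lines)
    show "(Z - E) \<inter> base_cell ` M = {}" using Mout base_self by blast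
  qed (simp add: fin)
  moreover have "card (Z - E) + card E = card Z"
    using fin E by (simp add: card_Diff_subset card_mono)
  ultimately show "card (expand Z E) + card E = card Z + (\<Sum>z\<in>E. card (long_lines z))"
    by (simp add: card_image)
qed

section \<open>Transversals and exchanges within them\<close>

definition transversal :: "('a label \<times> 'a label) set \<Rightarrow> bool" where
  "transversal Z \<longleftrightarrow> Z \<subseteq> labels \<times> labels \<and>
     (\<forall>l\<in>lines_over labels. \<exists>z\<in>Z. l \<in> cell_lines z) \<and> (\<forall>l. private_line Z l)"

text \<open>A surjective self-map of a finite set is injective, so it is enough that every column
  and every symbol occurs; injectivity then makes all lines private.\<close>

lemma transversal_graph:
  assumes \<tau>: "\<And>p. p \<in> labels \<Longrightarrow> \<tau> p \<in> labels"
    and col: "\<And>q. q \<in> labels \<Longrightarrow> \<exists>p\<in>labels. \<tau> p = q"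
    and sym: "\<And>q. q \<in> labels \<Longrightarrow> \<exists>p\<in>labels. prd p (\<tau> p) = q"
  shows "transversal ((\<lambda>p. (p, \<tau> p)) ` labels)"
    and "card ((\<lambda>p. (p, \<tau> p)) ` labels) = t\<^sup>2 + t"
proof -
  define Z where "Z = (\<lambda>p. (p, \<tau> p)) ` labels"
  have "\<tau> ` labels = labels" using \<tau> col by blast
  then have inj_\<tau>: "inj_on \<tau> labels"
    by (simp add: eq_card_imp_inj_on[OF finite_labels])
  have "(\<lambda>p. prd p (\<tau> p)) ` labels = labels" using \<tau> sym prd_closed by blast
  then have inj_sym: "inj_on (\<lambda>p. prd p (\<tau> p)) labels"
    by (simp add: eq_card_imp_inj_on[OF finite_labels])
  have "private_line Z l" for l
    unfolding private_line_def Z_def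
    using inj_\<tau> inj_sym by (cases l) (auto simp: inj_on_def)
  moreover have "\<exists>z\<in>Z. l \<in> cell_lines z" if "l \<in> lines_over labels" for l
    using that col sym unfolding lines_over_def Z_def by auto
  moreover have "Z \<subseteq> labels \<times> labels" using \<tau> unfolding Z_def by auto
  ultimately show "transversal ((\<lambda>p. (p, \<tau> p)) ` labels)"
    unfolding transversal_def Z_def by blast
  show "card ((\<lambda>p. (p, \<tau> p)) ` labels) = t\<^sup>2 + t"
    by (simp add: card_image inj_on_def card_labels)
qed

lemma long_lines_nonempty: "\<exists>l. l \<in> long_lines z"
proof -
  obtain p q where z: "z = (p, q)" by fastforce
  have "Row p \<in> long_lines z \<or> Col q \<in> long_lines z \<or> Sym (prd p q) \<in> long_lines z"
    unfolding z long_lines_def by (cases p; cases q) simp_all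
  then show ?thesis by blast
qed

text \<open>Distinct cells of a transversal share no line. As \<open>B\<close> covers just the lines
  of \<open>A\<close>, it shares none with \<open>Z - A\<close>, and coverage and privacy can be
  checked on the two pieces separately.\<close>

lemma transversal_exchange:
  assumes Z: "transversal Z" and A: "A \<subseteq> Z" and B: "B \<subseteq> labels \<times> labels"
    and lines: "(\<Union>z\<in>B. cell_lines z) = (\<Union>z\<in>A. cell_lines z)"
    and priv: "\<And>z. z \<in> B \<Longrightarrow> \<exists>l\<in>long_lines z. private_line B l"
  shows "good_cover (Z - A \<union> B)"
    and "card (Z - A \<union> B) + card A = card Z + card B"
    and "(Z - A) \<inter> B = {}"
    and "z \<in> Z - A \<Longrightarrow> l \<in> long_lines z \<Longrightarrow> private_line (Z - A \<union> B) l"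
    and "z \<in> B \<Longrightarrow> l \<in> long_lines z \<Longrightarrow> private_line B l \<Longrightarrow> private_line (Z - A \<union> B) l"
proof -
  have ZI: "Z \<subseteq> labels \<times> labels" and cov: "\<And>l. l \<in> lines_over labels \<Longrightarrow> \<exists>z\<in>Z. l \<in> cell_lines z"
    and pZ: "\<And>l. private_line Z l" using Z unfolding transversal_def by auto
  have sep: "l \<notin> cell_lines b" if "z \<in> Z - A" "l \<in> cell_lines z" "b \<in> B" for z l b
  proof
    assume "l \<in> cell_lines b"
    then obtain a where "a \<in> A" "l \<in> cell_lines a" using lines \<open>b \<in> B\<close> by blast
    then show False using pZ[of l] that A unfolding private_line_def by blast
  qed
  show out: "private_line (Z - A \<union> B) l" if "z \<in> Z - A" "l \<in> long_lines z" for z l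
    using sep[OF that(1)] that pZ[of l] unfolding private_line_def long_lines_def by blast
  show ins: "private_line (Z - A \<union> B) l" if "z \<in> B" "l \<in> long_lines z" "private_line B l" for z l
    using sep that unfolding private_line_def long_lines_def by blast
  show "good_cover (Z - A \<union> B)"
    unfolding good_cover_def
  proof (intro conjI ballI)
    show "Z - A \<union> B \<subseteq> labels \<times> labels" using ZI B by blast
    show "\<exists>z\<in>Z - A \<union> B. l \<in> cell_lines z" if "l \<in> lines_over labels" for l
      using cov[OF that] lines by blast
    show "\<exists>l\<in>long_lines z. private_line (Z - A \<union> B) l" if "z \<in> Z - A \<union> B" for z
    proof (cases "z \<in> B")
      case True
      then show ?thesis using priv ins by blast
    next
      case False
      then have "z \<in> Z - A" "z \<in> labels \<times> labels" using that ZI by auto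
      then show ?thesis using out long_lines_nonempty by blast
    qed
  qed
  have fin: "finite Z" "finite A" "finite B" using finite_cover ZI A B finite_subset by auto
  show "(Z - A) \<inter> B = {}"
    using sep B long_lines_nonempty unfolding long_lines_def by blast
  then have "card (Z - A \<union> B) = card (Z - A) + card B" by (simp add: card_Un_disjoint fin)
  moreover have "card (Z - A) + card A = card Z"
    using fin A by (simp add: card_Diff_subset card_mono)
  ultimately show "card (Z - A \<union> B) + card A = card Z + card B" by simp
qed

section \<open>Entries with three long lines and the attainable sizes\<close>

definition triple :: "'a label \<times> 'a label \<Rightarrow> bool" where
  "triple z \<longleftrightarrow> is_Long (fst z) \<and> is_Long (snd z) \<and> is_Long (prd (fst z) (snd z))"

lemma card_long_lines_triple: "triple z \<Longrightarrow> card (long_lines z) = 3"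
proof -
  assume z: "triple z"
  obtain p q where pq: "z = (p, q)" by fastforce
  have "long_lines z = {Row p, Col q, Sym (prd p q)}"
    using z unfolding pq long_lines_def triple_def by auto
  then show ?thesis by simp
qed

lemma triple_long: "triple z \<Longrightarrow> l \<in> cell_lines z \<Longrightarrow> long_line l"
  by (cases z) (auto simp: triple_def)

text \<open>A triple meets no short line, so the short lines stay covered by the other cells. Each
  triple gives way to three base cells, whence the step of 2.\<close>

lemma expand_triples:
  assumes Z: "good_cover Z" and E: "E \<subseteq> Z" and k: "k \<le> card E"
    and triple: "\<And>z. z \<in> E \<Longrightarrow> triple z"
    and priv: "\<And>z l. z \<in> E \<Longrightarrow> l \<in> long_lines z \<Longrightarrow> private_line Z l"
  shows "\<exists>Z'. good_cover Z' \<and> card Z' = card Z + 2 * k"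
proof -
  obtain D where D: "D \<subseteq> E" "card D = k" using obtain_subset_with_card_n[OF k] by metis
  have short: "\<exists>z\<in>expand Z D. l \<in> cell_lines z" if l: "l \<in> lines_over labels" "\<not> long_line l" for l
  proof -
    obtain z where z: "z \<in> Z" "l \<in> cell_lines z" using Z l(1) unfolding good_cover_def by blast
    then have "z \<notin> D" using triple triple_long D(1) l(2) by blast
    then show ?thesis using z unfolding expand_def by blast
  qed
  have "(\<Sum>z\<in>D. card (long_lines z)) = (\<Sum>z\<in>D. 3)"
    using D(1) triple card_long_lines_triple by (intro sum.cong) auto
  then have sum: "(\<Sum>z\<in>D. card (long_lines z)) = 3 * k" using D(2) by simp
  have ex: "good_cover (expand Z D)"
    "card (expand Z D) + card D = card Z + (\<Sum>z\<in>D. card (long_lines z))"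
    by (rule expand_good[OF Z]; use D E priv short in blast)+
  then show ?thesis using sum D(2) by (intro exI[of _ "expand Z D"]) auto
qed

lemma transversal_good:
  assumes "transversal Z" shows "good_cover Z"
proof -
  have "\<exists>l\<in>long_lines z. private_line Z l" for z
    using long_lines_nonempty[of z] assms by (auto simp: transversal_def)
  then show ?thesis using assms by (simp add: transversal_def good_cover_def)
qed

definition sizes :: "nat set" where
  "sizes = {card Z | Z. good_cover Z}"

lemma sizes_from_transversal:
  assumes "transversal Z" "k \<le> card {z \<in> Z. triple z}"
  shows "card Z + 2 * k \<in> sizes"
proof -
  have "\<exists>Z'. good_cover Z' \<and> card Z' = card Z + 2 * k"
    by (rule expand_triples[OF transversal_good[OF assms(1)] _ assms(2)])
      (use assms(1) in \<open>simp_all add: transversal_def\<close>)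
  then show ?thesis unfolding sizes_def by (metis (mono_tags, lifting) mem_Collect_eq)
qed

lemma latin_square_of_sizes:
  assumes "\<And>c. c \<in> A \<Longrightarrow> c \<in> sizes"
  shows "\<exists>L. latin_square (t\<^sup>2 + t) L \<and>
    (\<forall>c\<in>A. \<exists>C. minimal_cover (t\<^sup>2 + t) L C \<and> card C = c)"
proof -
  obtain L where L: "latin_square (t\<^sup>2 + t) L"
    and cov: "\<And>Z. irredundant_cover labels prd Z \<Longrightarrow>
      \<exists>C. minimal_cover (t\<^sup>2 + t) L C \<and> card C = card Z"
    using latin_square_transfer[OF finite_labels card_labels prd_closed prd_inj_right prd_inj_left]
    by blast
  have "\<exists>C. minimal_cover (t\<^sup>2 + t) L C \<and> card C = c" if c: "c \<in> A" for c
  proof -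
    obtain Z where "good_cover Z" "card Z = c" using assms[OF c] by (auto simp: sizes_def)
    then show ?thesis using cov[OF good_imp_irredundant] by blast
  qed
  with L show ?thesis by blast
qed

end

section \<open>Even order\<close>

locale half_system = unit_group +
  fixes H :: "'a set"
  assumes neg_one_G: "- 1 \<in> G" and H_sub: "H \<subseteq> G" and one_H: "1 \<in> H"
    and neg_H: "a \<in> G \<Longrightarrow> - a \<in> H \<longleftrightarrow> a \<notin> H"
begin

lemma neg_G: "a \<in> G \<Longrightarrow> - a \<in> G"
  using mult[OF neg_one_G, of a] by simp

lemma H_G: "a \<in> H \<Longrightarrow> a \<in> G"
  using H_sub by auto

lemma neg_one: "- 1 \<in> G" "- 1 \<notin> H"
  using neg_H[OF one] one_H neg_G[OF one] by auto

lemma one_neq: "(1::'a) \<noteq> - 1" "- 1 \<noteq> (1::'a)"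
proof -
  show "(1::'a) \<noteq> - 1"
  proof
    assume "(1::'a) = - 1"
    then have "- 1 \<in> H" using one_H by (rule subst)
    then show False using neg_one(2) by blast
  qed
  then show "- 1 \<noteq> (1::'a)" by (rule not_sym)
qed

declare one_neq [simp]

lemma card_H: "t = 2 * card H"
proof -
  have G: "G = H \<union> uminus ` H"
  proof (intro subset_antisym subsetI)
    fix a assume "a \<in> G"
    then have "a \<in> H \<or> - a \<in> H" using neg_H by auto
    moreover have "a \<in> uminus ` H" if "- a \<in> H" using imageI[OF that, of uminus] by simp
    ultimately show "a \<in> H \<union> uminus ` H" by blast
  next
    fix a assume "a \<in> H \<union> uminus ` H"
    then show "a \<in> G" using neg_G H_G by blast
  qed
  have "H \<inter> uminus ` H = {}" using neg_H H_G by blast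
  moreover have "finite H" using finite_subset[OF H_sub finite_G] .
  ultimately have "card (H \<union> uminus ` H) = card H + card (uminus ` H)"
    by (simp add: card_Un_disjoint)
  then have "t = card H + card (uminus ` H)" using G card_G by metis
  moreover have "card (uminus ` H) = card H" by (rule card_image) simp
  ultimately show ?thesis by simp
qed

text \<open>
  Let \<open>i \<in> H\<close>, \<open>i \<noteq> 1\<close>. In the columns and symbols given by this map the lines with the three indices
  \<open>(-i, i)\<close>, \<open>(i, 1)\<close>, \<open>(1, -i)\<close> are covered by two entries with three long lines and by one base
  entry of each kind, whose short lines are those of \<open>i\<close> and \<open>-i\<close>. For \<open>i = 1\<close> the first of
  these entries would have a short symbol; all four indices over \<open>\<plusminus>1\<close> are used instead, with three
  entries of the first sort.
\<close>

fun even_map :: "'a label \<Rightarrow> 'a label" where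
  "even_map (Short a) =
     (if a \<in> H then Short a else if a = -1 then Long (-1) (-1) else Long a (-a))"
| "even_map (Long w v) =
     (if w = 1 \<and> v = 1 then Long 1 (-1)
      else if w = 1 \<and> v = -1 then Long 1 1
      else if w = -1 \<and> v = -1 then Long (-1) 1
      else if w = -1 \<and> v = 1 then Short (-1)
      else if w = 1 \<and> v \<notin> H then Short v
      else if v = 1 \<and> w \<in> H then Long 1 (-w)
      else if v \<in> H \<and> w = -v then Long v 1
      else Long w v)"

definition even_transversal :: "('a label \<times> 'a label) set" where
  "even_transversal = (\<lambda>p. (p, even_map p)) ` labels"

lemma even_transversal:
  "transversal even_transversal" "card even_transversal = t\<^sup>2 + t"
proof -
  have closed: "even_map p \<in> labels" if "p \<in> labels" for p
    using that by (cases p) (auto simp: neg_one one neg_G H_G)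
  have col: "\<exists>p\<in>labels. even_map p = q" if "q \<in> labels" for q
  proof (cases q)
    case (Short a)
    then have a: "a \<in> G" using that by simp
    show ?thesis
    proof (cases "a \<in> H"; cases "a = -1")
      assume "a \<notin> H" "a = -1"
      then show ?thesis using Short neg_one one by (intro bexI[of _ "Long (-1) 1"]) auto
    next
      assume "a \<notin> H" "a \<noteq> -1"
      then show ?thesis using Short a neg_one one one_H by (intro bexI[of _ "Long 1 a"]) auto
    qed (use Short a in \<open>auto intro: bexI[of _ "Short a"]\<close>)
  next
    case (Long w v)
    then have wv: "w \<in> G" "v \<in> G" using that by auto
    \<comment> \<open>One case for each kind of long label that \<open>even_map\<close> moves, with
      the preimage as witness; every other long column is a fixed point.\<close>
    consider "w = 1" "v = 1" | "w = 1" "v = -1" | "w = -1" "v = -1" | "w = -1" "v = 1"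
      | "w = 1" "v \<notin> H" "v \<noteq> -1" | "v = 1" "w \<in> H" "w \<noteq> 1" | "v \<in> H" "w = -v" "v \<noteq> 1"
      | "even_map (Long w v) = Long w v"
      by (cases "even_map (Long w v) = Long w v") (auto split: if_splits)
    then show ?thesis
    proof cases
      case 1 then show ?thesis using Long neg_one one by (intro bexI[of _ "Long 1 (-1)"]) auto
    next
      case 2 then show ?thesis using Long neg_one one by (intro bexI[of _ "Long 1 1"]) auto
    next
      case 3 then show ?thesis using Long neg_one one by (intro bexI[of _ "Short (-1)"]) auto
    next
      case 4 then show ?thesis using Long neg_one one by (intro bexI[of _ "Long (-1) (-1)"]) auto
    next
      case 5
      then have "-v \<in> H" "-v \<noteq> 1" using neg_H wv by (auto, metis minus_minus)
      then show ?thesis using Long 5 neg_one one H_G by (intro bexI[of _ "Long (-v) 1"]) auto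
    next
      case 6
      then have "-w \<notin> H" "-w \<noteq> -1" using neg_H wv by auto
      then show ?thesis using Long 6 wv neg_one one H_G neg_G one_H
        by (intro bexI[of _ "Long (-w) w"]) auto
    next
      case 7
      then have "-v \<notin> H" "-v \<noteq> -1" using neg_H wv by auto
      then show ?thesis using Long 7 wv neg_one one H_G neg_G
        by (intro bexI[of _ "Short w"]) auto
    next
      case 8 then show ?thesis using Long that by blast
    qed
  qed
  have sym: "\<exists>p\<in>labels. prd p (even_map p) = q" if "q \<in> labels" for q
  proof (cases q)
    case (Short a)
    then have a: "a \<in> G" using that by simp
    consider "a = 1" | "a = -1" | "a \<in> H" "a \<noteq> 1" | "a \<notin> H" "a \<noteq> -1" by blast
    then show ?thesis
    proof cases
      case 1 then show ?thesis using Short neg_one one by (intro bexI[of _ "Long (-1) 1"]) auto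
    next
      case 2 then show ?thesis using Short neg_one one by (intro bexI[of _ "Short (-1)"]) auto
    next
      case 3
      then have "-a \<notin> H" "-a \<noteq> -1" using neg_H a by auto
      then show ?thesis using Short 3 a neg_G by (intro bexI[of _ "Short (-a)"]) auto
    next
      case 4
      then show ?thesis using Short a neg_one one one_H by (intro bexI[of _ "Long 1 a"]) auto
    qed
  next
    case (Long w v)
    then have wv: "w \<in> G" "v \<in> G" using that by auto
    \<comment> \<open>A fixed point \<open>Long w v\<close> is settled by the diagonal entry, whose
      symbol is again \<open>Long w v\<close>.\<close>
    consider "w \<in> H" "v = 1" | "w = 1" "v = -1" | "w = -1" "v = -1" | "w = -1" "v = 1"
      | "w = 1" "v \<notin> H" "v \<noteq> -1" | "v \<in> H" "w = -v" "v \<noteq> 1"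
      | "even_map (Long w v) = Long w v"
      by (cases "even_map (Long w v) = Long w v") (auto split: if_splits simp: one_H)
    then show ?thesis
    proof cases
      case 1 then show ?thesis using Long wv nz by (intro bexI[of _ "Short w"]) auto
    next
      case 2 then show ?thesis using Long neg_one one by (intro bexI[of _ "Long (-1) (-1)"]) auto
    next
      case 3 then show ?thesis using Long neg_one one by (intro bexI[of _ "Long 1 (-1)"]) auto
    next
      case 4 then show ?thesis using Long neg_one one by (intro bexI[of _ "Long 1 1"]) auto
    next
      case 5
      then have "-v \<in> H" "-v \<noteq> 1" using neg_H wv by (auto, metis minus_minus)
      then show ?thesis using Long 5 wv neg_one one H_G neg_G nz one_H
        by (intro bexI[of _ "Long v (-v)"]) auto
    next
      case 6
      then have "-v \<notin> H" "-v \<noteq> -1" using neg_H wv by auto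
      then show ?thesis using Long 6 wv neg_one one H_G neg_G nz one_H
        by (intro bexI[of _ "Long v 1"]) auto
    next
      case 7 then show ?thesis using Long that wv nz by (intro bexI[of _ "Long w v"]) auto
    qed
  qed
  show "transversal even_transversal" "card even_transversal = t\<^sup>2 + t"
    unfolding even_transversal_def using transversal_graph[of even_map] closed col sym by blast+
qed

section \<open>Even order: counting triples, sizes of both parities\<close>

abbreviation even_triples :: "('a label \<times> 'a label) set" where
  "even_triples \<equiv> {z \<in> even_transversal. triple z}"

lemma even_transversal_iff: "(p, q) \<in> even_transversal \<longleftrightarrow> p \<in> labels \<and> q = even_map p"
  by (auto simp: even_transversal_def)

lemma finite_even: "finite even_transversal"
  by (simp add: even_transversal_def finite_labels)

text \<open>Entries that are not triples occur only in the \<open>t\<close> short rows and in one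
  long row for each element of \<open>H\<close>.\<close>

lemma card_even_triples: "t\<^sup>2 \<le> card even_triples + card H"
proof -
  \<comment> \<open>\<open>k i\<close> is the long row whose base entry lies in column
    \<open>Short (- i)\<close>; \<open>i = 1\<close> is the exceptional case of
    \<open>even_map\<close>.\<close>
  define k where "k i = (if i = 1 then Long (-1) 1 else Long 1 (-i))" for i :: 'a
  define N where "N = Short ` G \<union> k ` H"
  have triple: "triple (Long w v, even_map (Long w v))"
    if "w \<in> G" "v \<in> G" "Long w v \<notin> k ` H" for w v
  proof -
    have 1: "\<not> (w = -1 \<and> v = 1)" using that(3) one_H by (auto simp: k_def)
    have 2: "\<not> (w = 1 \<and> v \<notin> H \<and> v \<noteq> -1)"
    proof
      assume v: "w = 1 \<and> v \<notin> H \<and> v \<noteq> -1"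
      then have "- v \<in> H" using neg_H that(2) by blast
      moreover have "- v \<noteq> 1" using v by (metis minus_minus)
      ultimately have "Long w v = k (- v)" using v by (simp add: k_def)
      then show False using \<open>- v \<in> H\<close> that(3) by blast
    qed
    have 3: "- w = 1 \<longleftrightarrow> w = -1" by (metis minus_minus)
    show ?thesis
      using 1 2 3 that(1,2) nz one_H by (auto simp: triple_def)
  qed
  have "even_transversal - even_triples \<subseteq> (\<lambda>p. (p, even_map p)) ` N"
  proof
    fix z assume z: "z \<in> even_transversal - even_triples"
    then obtain p where p: "p \<in> labels" "z = (p, even_map p)"
      by (auto simp: even_transversal_def)
    have "p \<in> N"
      using z p triple by (cases p) (auto simp: N_def even_transversal_def)
    then show "z \<in> (\<lambda>p. (p, even_map p)) ` N" using p by blast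
  qed
  moreover have fN: "finite N"
    using finite_G finite_subset[OF H_sub] by (simp add: N_def)
  ultimately have "card (even_transversal - even_triples) \<le> card N"
    by (meson card_image_le card_mono finite_imageI le_trans)
  also have "card N \<le> card (Short ` G) + card (k ` H)"
    unfolding N_def by (rule card_Un_le)
  also have "\<dots> \<le> t + card H"
    using card_image_le[OF finite_G, of Short] card_image_le[OF finite_subset[OF H_sub finite_G], of k]
    by (simp add: card_G)
  finally show ?thesis
    using even_transversal(2) finite_even by (simp add: card_Diff_subset)
qed

text \<open>Since \<open>t = 2 * card H\<close>, the largest \<open>k\<close> yields exactly
  \<open>3 * t\<^sup>2\<close>.\<close>

lemma even_sizes_0:
  assumes "k \<le> t\<^sup>2 - card H" shows "t\<^sup>2 + t + 2 * k \<in> sizes"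
  using sizes_from_transversal[OF even_transversal(1), of k] card_even_triples assms
  by (simp add: even_transversal(2))

text \<open>
  The lines with labels over \<open>\<plusminus>1\<close> carry a subsquare of order 6, which the transversal meets in
  \<open>even_out\<close>; \<open>even_in\<close> is a minimal cover of that subsquare with 7 entries.
\<close>

definition even_out :: "('a label \<times> 'a label) set" where
  "even_out = {(Short 1, Short 1), (Short (-1), Long (-1) (-1)), (Long (-1) 1, Short (-1)),
     (Long 1 1, Long 1 (-1)), (Long 1 (-1), Long 1 1), (Long (-1) (-1), Long (-1) 1)}"

definition even_in :: "('a label \<times> 'a label) set" where
  "even_in = {(Short 1, Short 1), (Short 1, Long 1 1), (Long 1 (-1), Short (-1)),
     (Short (-1), Short 1), (Long (-1) (-1), Long 1 (-1)), (Long 1 1, Long (-1) (-1)),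
     (Long (-1) 1, Long (-1) 1)}"

text \<open>The 7 cells of \<open>even_in\<close> have 21 incidences with the 18 lines of the
  subsquare. The three repeated lines are row, column and symbol \<open>Short 1\<close>, so every
  long line is private.\<close>

lemma even_exchange:
  "even_out \<subseteq> even_transversal"
  "even_in \<subseteq> labels \<times> labels"
  "(\<Union>z\<in>even_in. cell_lines z) = (\<Union>z\<in>even_out. cell_lines z)"
  "z \<in> even_in \<Longrightarrow> l \<in> long_lines z \<Longrightarrow> private_line even_in l"
  "card even_out = 6" "card even_in = 7"
proof -
  show "even_out \<subseteq> even_transversal"
    using one neg_one one_H by (simp add: even_out_def even_transversal_iff)
  show "even_in \<subseteq> labels \<times> labels"
    using one neg_one by (simp add: even_in_def)
  show "(\<Union>z\<in>even_in. cell_lines z) = (\<Union>z\<in>even_out. cell_lines z)"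
    unfolding even_in_def even_out_def by auto
  show "private_line even_in l" if "z \<in> even_in" "l \<in> long_lines z"
    using that unfolding private_line_def even_in_def long_lines_def by auto
  show "card even_out = 6" "card even_in = 7"
    unfolding even_in_def even_out_def by simp_all
qed

text \<open>The exchange removes at most three triples and brings in the two of \<open>B\<close>, so
  at most one expansion is lost; the sizes still reach \<open>3 * t\<^sup>2 - 1\<close>.\<close>

lemma even_sizes_1:
  assumes "k \<le> t\<^sup>2 - card H - 1" shows "t\<^sup>2 + t + 1 + 2 * k \<in> sizes"
proof -
  define Z where "Z = even_transversal - even_out \<union> even_in"
  define B where "B = {(Long 1 1, Long (-1) (-1)), (Long (-1) 1 :: 'a label, Long (-1) 1 :: 'a label)}"
  define E where "E = (even_triples - even_out) \<union> B"
  note ex = transversal_exchange[OF even_transversal(1) even_exchange(1-3), folded Z_def]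
  have priv_in: "\<exists>l\<in>long_lines z. private_line even_in l" if "z \<in> even_in" for z
    using long_lines_nonempty even_exchange(4)[OF that] by blast
  have Z: "good_cover Z" "card Z = t\<^sup>2 + t + 1"
    using ex(1)[OF priv_in] ex(2)[OF priv_in] even_exchange(5,6) even_transversal(2) by auto
  have B: "B \<subseteq> even_in" by (simp add: B_def even_in_def)
  have "even_triples \<inter> even_out \<subseteq>
      {(Long 1 1, Long 1 (-1)), (Long 1 (-1), Long 1 1), (Long (-1) (-1), Long (-1) 1)}"
    unfolding even_out_def triple_def by auto
  then have "card (even_triples \<inter> even_out) \<le>
      card {(Long 1 1, Long 1 (-1)), (Long 1 (-1), Long 1 1), (Long (-1) (-1) :: 'a label, Long (-1) 1 :: 'a label)}"
    by (rule card_mono[rotated]) simp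
  also have "\<dots> = 3" by simp
  finally have "card (even_triples - even_out) + 3 \<ge> card even_triples"
    using card_Diff_subset_Int[of even_triples even_out] finite_even by (simp add: even_out_def)
  moreover have "(even_triples - even_out) \<inter> B = {}" using ex(3)[OF priv_in] B by blast
  then have "card E = card (even_triples - even_out) + card B"
    unfolding E_def using finite_even by (simp add: card_Un_disjoint B_def)
  moreover have "card B = 2" by (simp add: B_def)
  ultimately have cE: "k \<le> card E" using card_even_triples assms by linarith
  have EZ: "E \<subseteq> Z" using B unfolding E_def Z_def by blast
  have tr: "triple z" if "z \<in> E" for z
    using that unfolding E_def B_def by (auto simp: triple_def)
  have "private_line Z l" if z: "z \<in> E" and l: "l \<in> long_lines z" for z l
  proof (cases "z \<in> B")
    case True
    then show ?thesis using ex(5)[OF priv_in] even_exchange(4) B l by blast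
  next
    case False
    then show ?thesis using ex(4)[OF priv_in] z l unfolding E_def by blast
  qed
  from expand_triples[OF Z(1) EZ cE tr this] show ?thesis
    unfolding sizes_def using Z(2) by force
qed

lemma even_sizes:
  assumes "c \<in> {t\<^sup>2 + t..3 * t\<^sup>2}" shows "c \<in> sizes"
proof -
  have le: "card H \<le> t\<^sup>2" using card_H by (simp add: power2_eq_square)
  define d where "d = c - (t\<^sup>2 + t)"
  have c: "c = t\<^sup>2 + t + d" and d: "d + 2 * card H \<le> 2 * t\<^sup>2"
    using assms card_H by (auto simp: d_def)
  show ?thesis
  proof (cases "even d")
    case True
    then obtain k where "d = 2 * k" by blast
    then show ?thesis using even_sizes_0[of k] c d by simp
  next
    case False
    then obtain k where "d = 2 * k + 1" by (blast elim: oddE)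
    then show ?thesis using even_sizes_1[of k] c d by simp
  qed
qed

end

section \<open>Odd order\<close>

locale odd_group = unit_group +
  fixes e :: 'a
  assumes sq_one: "a \<in> G \<Longrightarrow> a * a = 1 \<Longrightarrow> a = 1" and e_G: "e \<in> G" and e_neq: "e \<noteq> 1"
begin

text \<open>The root \<open>e\<close> of \<open>g\<close> serves to name the row
  \<open>Long (1 / e) (e * e * e)\<close> in which the transversal below meets column
  \<open>Short k\<close>. The choice \<open>k = g * g\<close> sends the symbols of the rows
  \<open>Long w (w * k)\<close> to labels of the form \<open>Long u u\<close>.\<close>

definition g :: 'a where "g = e * e"
definition k :: 'a where "k = g * g"

lemma gk_G: "g \<in> G" "k \<in> G"
  by (simp_all add: g_def k_def e_G mult)

lemma gk_neq: "g \<noteq> 1" "k \<noteq> 1" "k * k \<noteq> 1"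
proof -
  show g: "g \<noteq> 1" using sq_one[OF e_G] e_neq unfolding g_def by blast
  show k: "k \<noteq> 1" using sq_one[OF gk_G(1)] g unfolding k_def by blast
  show "k * k \<noteq> 1" using sq_one[OF gk_G(2)] k by blast
qed

lemma gk_nz: "e \<noteq> 0" "g \<noteq> 0" "k \<noteq> 0"
  using nz[OF e_G] nz[OF gk_G(1)] nz[OF gk_G(2)] by blast+

text \<open>Without elements of order two, squaring is injective and hence onto on the finite
  group.\<close>

lemma sqrt_ex:
  assumes "a \<in> G" shows "\<exists>s\<in>G. s * s = a"
proof -
  have "inj_on (\<lambda>s. s * s) G"
  proof (rule inj_onI)
    fix x y assume xy: "x \<in> G" "y \<in> G" "x * x = y * y"
    have "(x / y) * (x / y) = (x * x) / (y * y)" by simp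
    also have "\<dots> = 1" using nz[OF xy(2)] by (simp only: xy(3)) simp
    finally have "x / y = 1" using sq_one[OF divide[OF xy(1,2)]] by blast
    then show "x = y" using nz[OF xy(2)] by simp
  qed
  then have "(\<lambda>s. s * s) ` G = G"
    by (rule endo_inj_surj[OF finite_G, rotated]) (auto simp: mult)
  then have "a \<in> (\<lambda>s. s * s) ` G" using assms by (simp only:)
  then show ?thesis by blast
qed

text \<open>Three classes are rotated: the short labels, \<open>Long w w\<close> and
  \<open>Long w (w * k)\<close>. Rows of these classes, in this order, take columns of the second,
  third and first class and symbols of the third, first and second; all other rows keep their
  diagonal cell.\<close>

fun odd_map :: "'a label \<Rightarrow> 'a label" where
  "odd_map (Short a) = Long (a / k) (a / k)"
| "odd_map (Long w v) =
     (if v = w then Long (w / k) w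
      else if v = w * k then Short (w * v * g)
      else Long w v)"

definition odd_transversal :: "('a label \<times> 'a label) set" where
  "odd_transversal = (\<lambda>p. (p, odd_map p)) ` labels"

lemma div_k_neq: "a \<in> G \<Longrightarrow> a / k \<noteq> a" "a \<in> G \<Longrightarrow> a * k \<noteq> a" "a \<in> G \<Longrightarrow> a * g \<noteq> a"
  using gk_neq gk_nz nz by (auto simp: field_simps)

lemma prd_odd:
  "a \<in> G \<Longrightarrow> prd (Short a) (odd_map (Short a)) = Long (a / k) a"
  "w \<in> G \<Longrightarrow> prd (Long w w) (odd_map (Long w w)) = Short (w / k)"
  "w \<in> G \<Longrightarrow> prd (Long w (w * k)) (odd_map (Long w (w * k))) = Long (w * g) (w * g)"
  "w \<in> G \<Longrightarrow> v \<in> G \<Longrightarrow> v \<noteq> w \<Longrightarrow> v \<noteq> w * k \<Longrightarrow> prd (Long w v) (odd_map (Long w v)) = Long w v"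
  using gk_neq gk_nz nz by (auto simp: field_simps k_def)

lemma odd_transversal:
  "transversal odd_transversal" "card odd_transversal = t\<^sup>2 + t"
proof -
  have closed: "odd_map p \<in> labels" if "p \<in> labels" for p
    using that by (cases p) (auto simp: gk_G mult divide)
  have col: "\<exists>p\<in>labels. odd_map p = q" if "q \<in> labels" for q
  proof (cases q)
    case (Short a)
    \<comment> \<open>Column \<open>Short a\<close> is met in row \<open>Long s (s * k)\<close> when
      \<open>s * s * k * g = a\<close>, hence the square root.\<close>
    then have "a / (k * g) \<in> G" using that gk_G mult divide by simp
    then obtain s where s: "s \<in> G" "s * s = a / (k * g)" using sqrt_ex by blast
    have "s * (s * k) * g = (s * s) * (k * g)" by (simp add: mult_ac)
    then have "odd_map (Long s (s * k)) = Short a"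
      using s gk_nz div_k_neq by simp
    then show ?thesis using Short s gk_G mult by (intro bexI[of _ "Long s (s * k)"]) auto
  next
    case (Long w v)
    then have wv: "w \<in> G" "v \<in> G" using that by auto
    consider "v = w" | "v = w * k" | "v \<noteq> w" "v \<noteq> w * k" by blast
    then show ?thesis
    proof cases
      case 1
      then show ?thesis using Long wv gk_G gk_nz mult by (intro bexI[of _ "Short (w * k)"]) auto
    next
      case 2
      then show ?thesis using Long wv gk_nz by (intro bexI[of _ "Long v v"]) auto
    next
      case 3
      then show ?thesis using Long wv by (intro bexI[of _ "Long w v"]) auto
    qed
  qed
  have sym: "\<exists>p\<in>labels. prd p (odd_map p) = q" if "q \<in> labels" for q
  proof (cases q)
    case (Short a)
    then have "a * k \<in> G" using that gk_G mult by simp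
    then show ?thesis
      using prd_odd(2)[of "a * k"] Short gk_nz by (intro bexI[of _ "Long (a * k) (a * k)"]) auto
  next
    case (Long w v)
    then have wv: "w \<in> G" "v \<in> G" using that by auto
    consider "v = w" | "v = w * k" | "v \<noteq> w" "v \<noteq> w * k" by blast
    then show ?thesis
    proof cases
      case 1
      have w: "w / g \<in> G" using wv gk_G divide by blast
      have "prd (Long (w / g) (w / g * k)) (odd_map (Long (w / g) (w / g * k))) = q"
        unfolding prd_odd(3)[OF w] using Long 1 gk_nz by simp
      moreover have "Long (w / g) (w / g * k) \<in> labels"
        unfolding labels_simps using w gk_G(2) mult by blast
      ultimately show ?thesis by blast
    next
      case 2
      have "w * k \<in> G" using wv gk_G mult by blast
      then show ?thesis
        using prd_odd(1)[of "w * k"] Long 2 gk_nz by (intro bexI[of _ "Short (w * k)"]) auto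
    next
      case 3
      then show ?thesis using Long wv prd_odd(4) that by (intro bexI[of _ "Long w v"]) auto
    qed
  qed
  show "transversal odd_transversal" "card odd_transversal = t\<^sup>2 + t"
    unfolding odd_transversal_def using transversal_graph[of odd_map] closed col sym by blast+
qed

section \<open>Odd order: counting triples, sizes from the transversal\<close>

abbreviation odd_triples :: "('a label \<times> 'a label) set" where
  "odd_triples \<equiv> {z \<in> odd_transversal. triple z}"

lemma odd_transversal_iff: "(p, q) \<in> odd_transversal \<longleftrightarrow> p \<in> labels \<and> q = odd_map p"
  by (auto simp: odd_transversal_def)

lemma finite_odd: "finite odd_transversal"
  by (simp add: odd_transversal_def finite_labels)

lemma diagonal_odd_triple:
  assumes "w \<in> G" "v \<in> G" "v \<noteq> w" "v \<noteq> w * k"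
  shows "(Long w v, Long w v) \<in> odd_triples"
  using assms prd_odd(4)[OF assms] by (auto simp: odd_transversal_iff triple_def)

text \<open>Only the \<open>3 * t\<close> rows of the rotated classes can carry an entry that is not
  a triple.\<close>

lemma card_odd_triples: "t\<^sup>2 \<le> card odd_triples + 2 * t"
proof -
  define N where "N = Short ` G \<union> (\<lambda>w. Long w w) ` G \<union> (\<lambda>w. Long w (w * k)) ` G"
  have "odd_transversal - odd_triples \<subseteq> (\<lambda>p. (p, odd_map p)) ` N"
  proof
    fix z assume z: "z \<in> odd_transversal - odd_triples"
    then obtain p where p: "p \<in> labels" "z = (p, odd_map p)"
      by (auto simp: odd_transversal_def)
    have "p \<in> N"
    proof (cases p)
      case (Long w v)
      then have wv: "w \<in> G" "v \<in> G" using p by auto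
      have "v = w \<or> v = w * k"
      proof (rule ccontr)
        assume "\<not> (v = w \<or> v = w * k)"
        then show False using diagonal_odd_triple[OF wv] z p Long by auto
      qed
      then show ?thesis using Long wv by (auto simp: N_def)
    qed (use p in \<open>auto simp: N_def\<close>)
    then show "z \<in> (\<lambda>p. (p, odd_map p)) ` N" using p by blast
  qed
  moreover have fN: "finite N"
    using finite_G by (simp add: N_def)
  ultimately have "card (odd_transversal - odd_triples) \<le> card N"
    by (meson card_image_le card_mono finite_imageI le_trans)
  also have "card N \<le> card (Short ` G) + card ((\<lambda>w. Long w w) ` G) + card ((\<lambda>w. Long w (w * k)) ` G)"
    unfolding N_def by (meson add_mono card_Un_le le_refl le_trans)
  also have "\<dots> \<le> t + t + t"
    using card_image_le[OF finite_G] by (metis add_mono card_G)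
  finally show ?thesis
    using odd_transversal(2) finite_odd by (simp add: card_Diff_subset)
qed

lemma odd_sizes_0:
  assumes "j \<le> card odd_triples" shows "t\<^sup>2 + t + 2 * j \<in> sizes"
  using sizes_from_transversal[OF odd_transversal(1) assms] by (simp add: odd_transversal(2))

text \<open>An entry in a rotated class has just one short line: the row, the symbol or the column,
  depending on the class.\<close>

lemma card_long_lines_odd:
  assumes "z \<in> odd_transversal" "\<not> triple z" shows "card (long_lines z) = 2"
proof -
  obtain p where p: "p \<in> labels" "z = (p, odd_map p)"
    using assms(1) by (auto simp: odd_transversal_def)
  consider a where "p = Short a" "a \<in> G" | w where "p = Long w w" "w \<in> G"
    | w where "p = Long w (w * k)" "w \<in> G"
  proof (cases p)
    case (Long w v)
    then have "w \<in> G" "v \<in> G" using p by auto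
    have "v = w \<or> v = w * k"
    proof (rule ccontr)
      assume "\<not> (v = w \<or> v = w * k)"
      then show False
        using diagonal_odd_triple[OF \<open>w \<in> G\<close> \<open>v \<in> G\<close>] assms(2) p Long by auto
    qed
    then show ?thesis using that Long \<open>w \<in> G\<close> by blast
  qed (use p that in auto)
  then show ?thesis
  proof cases
    case 1
    then have "long_lines z = {Col (Long (a / k) (a / k)), Sym (Long (a / k) a)}"
      using p(2) prd_odd(1)[of a] unfolding long_lines_def by auto
    then show ?thesis by simp
  next
    case 2
    then have "long_lines z = {Row (Long w w), Col (Long (w / k) w)}"
      using p(2) prd_odd(2)[of w] unfolding long_lines_def by auto
    then show ?thesis by simp
  next
    case 3
    then have "long_lines z = {Row (Long w (w * k)), Sym (Long (w * g) (w * g))}"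
      using p(2) prd_odd(3)[of w] div_k_neq unfolding long_lines_def by auto
    then show ?thesis by simp
  qed
qed

text \<open>All triples are expanded, then \<open>j\<close> entries with two long lines, each
  raising the size by one. The latter may take away the cover of a short line, so the base cells of
  the triples must cover all short lines.\<close>

lemma odd_sizes_2:
  assumes "j \<le> t\<^sup>2 + t - card odd_triples"
  shows "t\<^sup>2 + t + 2 * card odd_triples + j \<in> sizes"
proof -
  have "card (odd_transversal - odd_triples) = t\<^sup>2 + t - card odd_triples"
    using odd_transversal(2) finite_odd by (simp add: card_Diff_subset)
  then obtain X where X: "X \<subseteq> odd_transversal - odd_triples" "card X = j"
    using obtain_subset_with_card_n[of j "odd_transversal - odd_triples"] assms by auto
  define E where "E = odd_triples \<union> X"
  have fin: "finite odd_triples" "finite X" using finite_odd X(1) finite_subset by auto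
  have disj: "odd_triples \<inter> X = {}" using X(1) by blast
  have base: "base_cell l \<in> expand odd_transversal E"
    if "w \<in> G" "v \<in> G" "v \<noteq> w" "v \<noteq> w * k" "l \<in> long_lines (Long w v, Long w v)" for w v l
    using diagonal_odd_triple[OF that(1-4)] that(5) unfolding expand_def E_def by blast
  have short: "\<exists>z\<in>expand odd_transversal E. l \<in> cell_lines z"
    if l: "l \<in> lines_over labels" "\<not> long_line l" for l
  proof -
    obtain a where a: "a \<in> G" "l = Row (Short a) \<or> l = Col (Short a) \<or> l = Sym (Short a)"
    proof (cases l)
      case (Row p) then show ?thesis using that l by (cases p) (auto simp: lines_over_def)
    next
      case (Col p) then show ?thesis using that l by (cases p) (auto simp: lines_over_def)
    next
      case (Sym p) then show ?thesis using that l by (cases p) (auto simp: lines_over_def)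
    qed
    obtain s where s: "s \<in> G" "s * s = a" using sqrt_ex a(1) by blast
    \<comment> \<open>Row, column and symbol \<open>Short a\<close> in turn, from diagonal triples
      at \<open>Long w v\<close> with \<open>v = w / k\<close>, which differs from \<open>w\<close>
      and \<open>w * k\<close> because \<open>k \<noteq> 1\<close> and
      \<open>k * k \<noteq> 1\<close>. The column requires \<open>w * v = a\<close>, hence the root
      \<open>s\<close>.\<close>
    have "base_cell (Col (Long a (a / k))) \<in> expand odd_transversal E"
      by (rule base[of a "a / k"])
        (use a(1) gk_G gk_neq gk_nz nz divide in \<open>auto simp: long_lines_def field_simps\<close>)
    moreover have "base_cell (Row (Long (s * g) (s / g))) \<in> expand odd_transversal E"
      by (rule base[of "s * g" "s / g"])
        (use s(1) gk_G gk_neq gk_nz nz divide mult in \<open>auto simp: long_lines_def field_simps k_def\<close>)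
    moreover have "base_cell (Row (Long (a * k) a)) \<in> expand odd_transversal E"
      by (rule base[of "a * k" a])
        (use a(1) gk_G gk_neq gk_nz nz mult in \<open>auto simp: long_lines_def\<close>)
    moreover have "s * g * (s / g) = a" using s(2) gk_nz by simp
    ultimately show ?thesis using a(2) by force
  qed
  have priv: "private_line odd_transversal l" for l
    using odd_transversal(1) unfolding transversal_def by blast
  have EZ: "E \<subseteq> odd_transversal" using X(1) unfolding E_def by blast
  note ex = expand_good[OF transversal_good[OF odd_transversal(1)] EZ priv short]
  have "(\<Sum>z\<in>E. card (long_lines z)) =
      (\<Sum>z\<in>odd_triples. card (long_lines z)) + (\<Sum>z\<in>X. card (long_lines z))"
    unfolding E_def by (rule sum.union_disjoint[OF fin disj])
  also have "(\<Sum>z\<in>odd_triples. card (long_lines z)) = 3 * card odd_triples"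
    by (simp add: card_long_lines_triple)
  also have "(\<Sum>z\<in>X. card (long_lines z)) = (\<Sum>z\<in>X. 2)"
    using X(1) card_long_lines_odd by (intro sum.cong) auto
  finally have "card (expand odd_transversal E) + card E =
      t\<^sup>2 + t + (3 * card odd_triples + 2 * j)"
    using ex(2) X(2) odd_transversal(2) by simp
  moreover have "card E = card odd_triples + j"
    unfolding E_def using card_Un_disjoint[OF fin disj] X(2) by simp
  ultimately have "card (expand odd_transversal E) = t\<^sup>2 + t + 2 * card odd_triples + j"
    by simp
  then show ?thesis using ex(1) unfolding sizes_def by force
qed

text \<open>
  Only the first two entries of \<open>odd_out\<close> really change: six lines covered by two entries are covered
  by three entries with two of these lines each. The other three entries, common to both sets, are
  those that meet the additional lines of the new entries; with them both sets cover the same lines.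
\<close>

definition odd_out :: "('a label \<times> 'a label) set" where
  "odd_out = {(Long k 1, Long k 1), (Short k, Long 1 1), (Long k k, Long 1 k),
     (Long 1 1, Long (1 / k) 1), (Long (1 / e) (e * e * e), Short k)}"

definition odd_in :: "('a label \<times> 'a label) set" where
  "odd_in = {(Long k 1, Long 1 1), (Short k, Short k), (Long k k, Long k 1),
     (Long k k, Long 1 k), (Long 1 1, Long (1 / k) 1), (Long (1 / e) (e * e * e), Short k)}"

lemma odd_exchange:
  "odd_out \<subseteq> odd_transversal"
  "odd_in \<subseteq> labels \<times> labels"
  "(\<Union>z\<in>odd_in. cell_lines z) = (\<Union>z\<in>odd_out. cell_lines z)"
  "z \<in> odd_in \<Longrightarrow> \<exists>l\<in>long_lines z. private_line odd_in l"
  "card odd_out = 5" "card odd_in = 6"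
proof -
  have k1: "k \<noteq> 1" "1 \<noteq> k" "k * k \<noteq> 1" "1 \<noteq> k * k" "1 / k \<noteq> k" "k \<noteq> 1 / k"
    using gk_neq gk_nz by (auto simp: field_simps)
  have e2: "e * e \<noteq> 1" using sq_one e_G e_neq by blast
  have ke: "k = e * (e * e * e)" by (simp add: k_def g_def mult_ac)
  \<comment> \<open>\<open>k3\<close> and \<open>ek\<close> keep row
    \<open>Long (1 / e) (e * e * e)\<close> apart from \<open>Long k k\<close> and
    \<open>Long k 1\<close>; \<open>k2\<close> makes its symbol in column \<open>Short k\<close>
    long. As \<open>e * e * e = 1\<close> is possible, \<open>ek\<close> excludes its two equations
    only jointly.\<close>
  have k3: "k \<noteq> e * e * e"
    using e_neq gk_nz unfolding ke by simp
  have k2: "k \<noteq> e * e"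
    using e2 gk_nz unfolding ke by (simp add: mult.assoc)
  have ek: "\<not> (k = 1 / e \<and> 1 = e * e * e)"
  proof
    assume "k = 1 / e \<and> 1 = e * e * e"
    then have "k = e" "k = 1 / e" unfolding ke by (simp, blast)
    then have "e = 1 / e" by (rule subst)
    then show False using e2 gk_nz by (simp add: field_simps)
  qed
  have prds:
    "prd (Long k 1) (Long 1 1) = Short (1 / k)" "prd (Short k) (Short k) = Long k 1"
    "prd (Long k k) (Long k 1) = Long 1 k" "prd (Long k k) (Long 1 k) = Short 1"
    "prd (Long 1 1) (Long (1 / k) 1) = Short (1 / k)"
    "prd (Long k 1) (Long k 1) = Long k 1" "prd (Short k) (Long 1 1) = Long 1 k"
    using k1 gk_nz by simp_all
  have prde: "prd (Long (1 / e) (e * e * e)) (Short k) = Long e e"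
    using k2 gk_nz by (simp add: ke)
  have "odd_map (Long (1 / e) (e * e * e)) = Short k"
    using k1(1) gk_nz by (simp add: ke g_def field_simps)
  then show "odd_out \<subseteq> odd_transversal"
    using k1 gk_nz gk_G one e_G mult divide
    by (simp add: odd_out_def odd_transversal_iff)
  show "odd_in \<subseteq> labels \<times> labels"
    using one gk_G e_G mult divide by (simp add: odd_in_def)
  show "(\<Union>z\<in>odd_in. cell_lines z) = (\<Union>z\<in>odd_out. cell_lines z)"
    unfolding odd_in_def odd_out_def by (simp add: prds prde del: prd.simps) blast
  show "\<exists>l\<in>long_lines z. private_line odd_in l" if "z \<in> odd_in"
  proof -
    have rows: "private_line odd_in (Row (Long k 1))" "private_line odd_in (Row (Long 1 1))"
      "private_line odd_in (Row (Long (1 / e) (e * e * e)))"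
      unfolding private_line_def odd_in_def using k1 k3 ek e_neq gk_nz by auto
    have cols: "private_line odd_in (Col (Long k 1))" "private_line odd_in (Col (Long 1 k))"
      unfolding private_line_def odd_in_def using k1 by auto
    have sym: "private_line odd_in (Sym (Long k 1))"
      unfolding private_line_def odd_in_def using k1 e_neq
      by (auto simp: prds prde simp del: prd.simps)
    show ?thesis
      using that rows cols sym unfolding odd_in_def long_lines_def
      by (auto simp: prds prde simp del: prd.simps)
  qed
  show "card odd_out = 5" "card odd_in = 6"
    unfolding odd_in_def odd_out_def using k1 by simp_all
qed

text \<open>The only triple in \<open>odd_out\<close> is \<open>(Long k 1, Long k 1)\<close>, so the
  exchange costs one expansion.\<close>

lemma odd_sizes_1:
  assumes "Suc j \<le> card odd_triples" shows "t\<^sup>2 + t + 1 + 2 * j \<in> sizes"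
proof -
  define Z where "Z = odd_transversal - odd_out \<union> odd_in"
  define E where "E = odd_triples - odd_out"
  note ex = transversal_exchange[OF odd_transversal(1) odd_exchange(1-4), folded Z_def]
  have Z: "good_cover Z" "card Z = t\<^sup>2 + t + 1"
    using ex(1,2) odd_exchange(5,6) odd_transversal(2) by auto
  have "odd_triples \<inter> odd_out \<subseteq> {(Long k 1, Long k 1)}"
    unfolding odd_out_def triple_def using gk_neq gk_nz by auto
  then have "card (odd_triples \<inter> odd_out) \<le> card {(Long k 1, Long k 1)}"
    by (rule card_mono[rotated]) simp
  then have "card E + 1 \<ge> card odd_triples"
    using card_Diff_subset_Int[of odd_triples odd_out] finite_odd by (simp add: odd_out_def E_def)
  then have cE: "j \<le> card E" using assms by linarith
  have EZ: "E \<subseteq> Z" unfolding E_def Z_def by blast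
  have tr: "triple z" if "z \<in> E" for z using that unfolding E_def by blast
  have "private_line Z l" if "z \<in> E" "l \<in> long_lines z" for z l
    using ex(4) that unfolding E_def by blast
  from expand_triples[OF Z(1) EZ cE tr this] show ?thesis
    unfolding sizes_def using Z(2) by force
qed

lemma odd_sizes:
  assumes "c \<in> {t\<^sup>2 + t..3 * t\<^sup>2}" shows "c \<in> sizes"
proof -
  define m where "m = card odd_triples"
  have m: "t\<^sup>2 \<le> m + 2 * t" using card_odd_triples by (simp add: m_def)
  define d where "d = c - (t\<^sup>2 + t)"
  have c: "c = t\<^sup>2 + t + d" and d: "d + t \<le> 2 * t\<^sup>2"
    using assms by (auto simp: d_def)
  define j where "j = d div 2"
  show ?thesis
  \<comment> \<open>Below \<open>2 * m\<close> expanding triples reaches both parities. From there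
    on all triples are expanded, and \<open>m \<ge> t\<^sup>2 - 2 * t\<close> leaves enough further
    entries to reach \<open>3 * t\<^sup>2\<close>.\<close>
  proof (cases "2 * m \<le> d")
    case True
    have "d - 2 * m \<le> t\<^sup>2 + t - m" using True d m by linarith
    then have "t\<^sup>2 + t + 2 * m + (d - 2 * m) \<in> sizes" unfolding m_def by (rule odd_sizes_2)
    then show ?thesis using True c by (simp add: add.assoc)
  next
    case False
    have "d = 2 * j \<or> d = 2 * j + 1" unfolding j_def by presburger
    then show ?thesis
    proof
      assume "d = 2 * j"
      then show ?thesis using odd_sizes_0[of j] c False by (simp add: m_def)
    next
      assume "d = 2 * j + 1"
      then show ?thesis using odd_sizes_1[of j] c False by (simp add: m_def)
    qed
  qed
qed

end

section \<open>Roots of unity\<close>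

lemma unit_group_roots_of_unity:
  assumes "0 < t" shows "unit_group {z::complex. z ^ t = 1} t"
proof
  show "card {z::complex. z ^ t = 1} = t" using card_roots_unity_eq[OF assms] .
qed (use assms in \<open>auto simp: power_mult_distrib power_divide power_0_left\<close>)

text \<open>The open upper half plane with the positive real axis contains exactly one of
  \<open>z\<close> and \<open>- z\<close> for nonzero \<open>z\<close>; evenness of \<open>t\<close>
  makes \<open>- z\<close> a root of unity again.\<close>

lemma half_system_roots_of_unity:
  assumes "0 < t" "even t"
  shows "half_system {z::complex. z ^ t = 1} t
    {z. z ^ t = 1 \<and> (0 < Im z \<or> Im z = 0 \<and> 0 < Re z)}"
proof -
  interpret unit_group "{z::complex. z ^ t = 1}" t
    using unit_group_roots_of_unity[OF assms(1)] .
  show ?thesis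
  proof
    fix z :: complex assume z: "z \<in> {z. z ^ t = 1}"
    then have "z \<noteq> 0" using assms(1) by (auto simp: power_0_left)
    then have "Re z \<noteq> 0 \<or> Im z \<noteq> 0" by (simp add: complex_eq_iff)
    then show "- z \<in> {z. z ^ t = 1 \<and> (0 < Im z \<or> Im z = 0 \<and> 0 < Re z)} \<longleftrightarrow>
        z \<notin> {z. z ^ t = 1 \<and> (0 < Im z \<or> Im z = 0 \<and> 0 < Re z)}"
      using z assms(2) by auto
  qed (use assms in auto)
qed

lemma odd_group_roots_of_unity:
  assumes "1 < t" "odd t"
  obtains e where "odd_group {z::complex. z ^ t = 1} t e"
proof -
  have t: "0 < t" using assms(1) by simp
  interpret unit_group "{z::complex. z ^ t = 1}" t
    using unit_group_roots_of_unity[OF t] .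
  have "{z::complex. z ^ t = 1} \<noteq> {1}" using card_G assms(1) by auto
  then obtain e :: complex where e: "e ^ t = 1" "e \<noteq> 1" by auto
  have "odd_group {z::complex. z ^ t = 1} t e"
  proof
    fix z :: complex assume z: "z \<in> {z. z ^ t = 1}" "z * z = 1"
    \<comment> \<open>An odd exponent turns \<open>z * z = 1\<close> into
      \<open>z ^ t = z\<close>.\<close>
    obtain m where "t = 2 * m + 1" using assms(2) by (elim oddE)
    then have "z ^ t = (z * z) ^ m * z" by (simp add: power_mult power2_eq_square)
    then show "z = 1" using z by simp
  qed (use e in auto)
  then show ?thesis by (rule that)
qed

theorem theorem3p5:
  fixes t :: nat
  assumes "t \<ge> 2"
  shows "\<exists>L. latin_square (t^2 + t) L \<and>
           (\<forall>c\<in>{t^2 + t..3 * t^2}. \<exists>C. minimal_cover (t^2 + t) L C \<and> card C = c)"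
proof -
  have t: "0 < t" "1 < t" using assms by auto
  interpret unit_group "{z::complex. z ^ t = 1}" t
    using unit_group_roots_of_unity[OF t(1)] .
  have "c \<in> sizes" if "c \<in> {t\<^sup>2 + t..3 * t\<^sup>2}" for c
  proof (cases "even t")
    case True
    then show ?thesis
      using half_system.even_sizes[OF half_system_roots_of_unity[OF t(1)] that] by blast
  next
    case False
    then obtain e where "odd_group {z::complex. z ^ t = 1} t e"
      using odd_group_roots_of_unity[OF t(2)] by blast
    then show ?thesis using odd_group.odd_sizes[OF _ that] by blast
  qed
  then show ?thesis by (rule latin_square_of_sizes)
qed

end
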